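(* Let $m\ge 2$ and $n\ge 3$ be integers. Let the list $(\rho,\lambda_2,\lambda_3,\ldots,\lambda_m)$ of complex numbers be realisable, where $\rho$ is the Perron eigenvalue, $\lambda_2$ is real and $\rho\neq\lambda_2$. Let $b_1$ be any real number such that \[ \gamma:=\frac{\rho+\lambda_2-b_1}{2}\geq 0, \] let \[ b_2:=\frac{(\rho-\lambda_2)^2-b_1^2}{4}, \] and let $b_3,b_4,\ldots,b_n$ be any nonnegative numbers. Then the list \[ (\mu_1,\mu_2,\ldots,\mu_n,\lambda_3,\lambda_4,\ldots,\lambda_m) \] is realisable, where $\mu_1,\ldots,\mu_n$ are the roots (with multiplicity) of the polynomial \[ w(x):=(x-\gamma)^n-b_1(x-\gamma)^{n-1}-b_2(x-\gamma)^{n-2}-\cdots-b_{n-1}(x-\gamma)-b_n. \]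
   Context: A list of complex numbers $(\lambda_1,\ldots,\lambda_k)$ is called realisable if there is a $k\times k$ entrywise nonnegative real matrix whose spectrum (eigenvalues counted with algebraic multiplicity) is this list. The order of entries is immaterial, except that when the first entry $\rho$ of a realisable list is said to be the Perron eigenvalue, this means that $\rho$ is the spectral radius of a realising matrix, i.e. $\rho$ is a nonnegative real number equal to the maximum of the moduli of the entries of the list. *)

theory Defs
  imports "Jordan_Normal_Form.Spectral_Radius"
begin

definition realises :: "real mat \<Rightarrow> complex list \<Rightarrow> bool" where
  "realises A ls \<longleftrightarrow>
     A \<in> carrier_mat (length ls) (length ls) \<and>
     (\<forall>i < length ls. \<forall>j < length ls. A $$ (i, j) \<ge> 0) \<and>
     proots (char_poly (map_mat complex_of_real A)) = mset ls"

definition realisable :: "complex list \<Rightarrow> bool" where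
  "realisable ls \<longleftrightarrow> (\<exists>A. realises A ls)"

(* Meaningful for nonempty lists only: the spectral radius of the 0 x 0 matrix is unspecified. *)
definition perron_eigenvalue :: "real \<Rightarrow> complex list \<Rightarrow> bool" where
  "perron_eigenvalue \<rho> ls \<longleftrightarrow>
     (\<exists>A. realises A ls \<and> spectral_radius (map_mat complex_of_real A) = \<rho>)"

definition w_poly :: "nat \<Rightarrow> real \<Rightarrow> (nat \<Rightarrow> real) \<Rightarrow> real poly" where
  "w_poly n \<gamma> b = [:- \<gamma>, 1:] ^ n - (\<Sum>i = 1..n. Polynomial.smult (b i) ([:- \<gamma>, 1:] ^ (n - i)))"

end

theory Submission
  imports Defs
begin

text \<open>
  Shifting by \<open>\<gamma>\<close>, the choice of \<open>b 1\<close> and \<open>b 2\<close> means that with \<open>y = x - \<gamma>\<close> and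
  \<open>q = (x - \<rho>) (x - lam2)\<close> the polynomial \<open>w\<close> is \<open>y^(n-2) q\<close> minus the terms with
  \<open>b 3, \<dots>, b n\<close>. The realising matrix may be replaced by a cospectral nonnegative matrix \<open>B\<close> with
  constant row sums \<open>\<rho>\<close>: scale \<open>A + J/k\<close> by its positive Perron vector and pass to a limit.
  Adding to an eigenvector of \<open>lam2\<close> (of suitable sign) the constant vector that makes its least
  entry zero gives \<open>z \<ge> 0\<close> with \<open>z p = 0\<close>, \<open>(B - \<rho>) (B - lam2) z = 0\<close> and
  \<open>\<kappa> = (B z) p > 0\<close>; equivalently, the \<open>p\<close>-th entry of \<open>(x - B)^-1 z\<close> is \<open>\<kappa> / q\<close>.
  Border \<open>B\<close> by an upper bidiagonal block of size \<open>n - 2\<close> with diagonal \<open>\<gamma>\<close> and superdiagonal 1,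
  placing \<open>z\<close> in the first column below it and \<open>b 3 / \<kappa>, \<dots>, b n / \<kappa>\<close> to its right in the column
  of index \<open>p\<close> of \<open>B\<close>. A Schur complement shows that the resulting nonnegative matrix has
  characteristic polynomial \<open>char_poly B * w / q\<close>.
\<close>

section \<open>Positive matrices and their Perron vectors\<close>

lemma mult_mat_vec_index:
  assumes "A \<in> carrier_mat n m" "v \<in> carrier_vec m" "i < n"
  shows "(A *\<^sub>v v) $ i = (\<Sum>j<m. A $$ (i, j) * v $ j)"
  using assms by (auto simp: scalar_prod_def lessThan_atLeast0 intro!: sum.cong)

lemma pow_mat_nonneg:
  fixes P :: "real mat"
  assumes P: "P \<in> carrier_mat n n" and nn: "\<And>i j. i < n \<Longrightarrow> j < n \<Longrightarrow> 0 \<le> P $$ (i, j)"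
  shows "i < n \<Longrightarrow> j < n \<Longrightarrow> 0 \<le> (P ^\<^sub>m k) $$ (i, j)"
proof (induction k arbitrary: i j)
  case 0
  then show ?case using P by (auto simp: one_mat_def)
next
  case (Suc k)
  then have "(P ^\<^sub>m Suc k) $$ (i, j) = (\<Sum>l<n. (P ^\<^sub>m k) $$ (i, l) * P $$ (l, j))"
    using P by (auto simp: scalar_prod_def lessThan_atLeast0 intro!: sum.cong)
  then show ?case using Suc nn by (auto intro!: sum_nonneg)
qed

text \<open>Multiplying \<open>t w \<le> P w\<close> by the nonnegative matrix
  \<open>P ^\<^sub>m k\<close> preserves it, so each further power of \<open>P\<close> gains a
  factor \<open>t\<close>.\<close>

lemma pow_mat_mult_vec_ge:
  fixes P :: "real mat"
  assumes P: "P \<in> carrier_mat n n" and nn: "\<And>i j. i < n \<Longrightarrow> j < n \<Longrightarrow> 0 \<le> P $$ (i, j)"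
    and w: "w \<in> carrier_vec n" and t: "0 \<le> t"
    and ge: "\<And>i. i < n \<Longrightarrow> t * w $ i \<le> (P *\<^sub>v w) $ i"
  shows "i < n \<Longrightarrow> t ^ k * w $ i \<le> (P ^\<^sub>m k *\<^sub>v w) $ i"
proof (induction k arbitrary: i)
  case 0
  then show ?case using P w by simp
next
  case (Suc k)
  have Pk: "P ^\<^sub>m k \<in> carrier_mat n n" using P by simp
  have "t ^ Suc k * w $ i = t * (t ^ k * w $ i)" by simp
  also have "\<dots> \<le> t * (P ^\<^sub>m k *\<^sub>v w) $ i"
    using Suc t by (intro mult_left_mono) auto
  also have "\<dots> = (\<Sum>j<n. (P ^\<^sub>m k) $$ (i, j) * (t * w $ j))"
    by (simp add: mult_mat_vec_index[OF Pk w Suc.prems] sum_distrib_left mult_ac)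
  also have "\<dots> \<le> (\<Sum>j<n. (P ^\<^sub>m k) $$ (i, j) * (P *\<^sub>v w) $ j)"
    using Suc.prems ge pow_mat_nonneg[OF P nn] by (intro sum_mono mult_left_mono) auto
  also have "\<dots> = (P ^\<^sub>m k *\<^sub>v (P *\<^sub>v w)) $ i"
    using P w by (subst mult_mat_vec_index[OF Pk _ Suc.prems]) auto
  also have "P ^\<^sub>m k *\<^sub>v (P *\<^sub>v w) = P ^\<^sub>m Suc k *\<^sub>v w"
    using P w Pk by (simp add: assoc_mult_mat_vec[OF Pk P w])
  finally show ?case .
qed

lemma map_mat_of_real_pow:
  fixes P :: "real mat"
  assumes "P \<in> carrier_mat n n"
  shows "map_mat complex_of_real P ^\<^sub>m k = map_mat complex_of_real (P ^\<^sub>m k)"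
  using assms of_real_hom.mat_hom_pow by metis

text \<open>An eigenvector of \<open>a Q\<close> for \<open>e\<close> is one of \<open>Q\<close> for
  \<open>e / a\<close>. This allows a matrix to be scaled to spectral radius below 1.\<close>

lemma spectral_radius_smult_le:
  assumes Q: "Q \<in> carrier_mat n n" and n: "0 < n" and a: "0 < a"
  shows "spectral_radius (complex_of_real a \<cdot>\<^sub>m Q) \<le> a * spectral_radius Q"
proof -
  let ?aQ = "complex_of_real a \<cdot>\<^sub>m Q"
  have aQ: "?aQ \<in> carrier_mat n n" using Q by simp
  obtain e where e: "e \<in> spectrum ?aQ" "spectral_radius ?aQ = norm e"
    using spectral_radius_mem_max(1)[OF aQ n] by auto
  then obtain v where v: "eigenvector ?aQ v e"
    by (auto simp: spectrum_def eigenvalue_def)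
  have vc: "v \<in> carrier_vec n" using v Q by (auto simp: eigenvector_def)
  have "Q *\<^sub>v v = (e / of_real a) \<cdot>\<^sub>v v"
  proof (rule eq_vecI)
    fix i assume i: "i < dim_vec ((e / of_real a) \<cdot>\<^sub>v v)"
    then have i: "i < n" using vc by simp
    have "(?aQ *\<^sub>v v) $ i = e * v $ i" using v i vc by (simp add: eigenvector_def)
    moreover have "(?aQ *\<^sub>v v) $ i = of_real a * (Q *\<^sub>v v) $ i"
      by (simp add: mult_mat_vec_index[OF aQ vc i] mult_mat_vec_index[OF Q vc i]
          sum_distrib_left mult.assoc i Q[THEN carrier_matD(1)] Q[THEN carrier_matD(2)])
    ultimately show "(Q *\<^sub>v v) $ i = ((e / of_real a) \<cdot>\<^sub>v v) $ i"
      using a i vc by (simp add: field_simps)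
  qed (use Q vc in auto)
  then have "e / of_real a \<in> spectrum Q"
    using v Q by (auto simp: spectrum_def eigenvalue_def eigenvector_def)
  then have "norm (e / of_real a) \<le> spectral_radius Q"
    by (intro spectral_radius_mem_max(2)[OF Q n]) auto
  then show ?thesis using e a by (simp add: norm_divide field_simps)
qed

text \<open>Were the radius smaller than \<open>t\<close>, a suitable multiple of \<open>P\<close>
  would have bounded powers by its Jordan form, while subinvariance forces those powers to grow
  geometrically on \<open>w\<close>.\<close>

lemma subinvariance_le_spectral_radius:
  fixes P :: "real mat"
  assumes P: "P \<in> carrier_mat n n" and n: "0 < n"
    and nn: "\<And>i j. i < n \<Longrightarrow> j < n \<Longrightarrow> 0 \<le> P $$ (i, j)"
    and w: "w \<in> carrier_vec n" and wpos: "\<And>i. i < n \<Longrightarrow> 0 < w $ i"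
    and ge: "\<And>i. i < n \<Longrightarrow> t * w $ i \<le> (P *\<^sub>v w) $ i"
  shows "t \<le> spectral_radius (map_mat complex_of_real P)"
proof (rule ccontr)
  let ?Q = "map_mat complex_of_real P"
  assume "\<not> ?thesis"
  moreover have Q: "?Q \<in> carrier_mat n n" using P by simp
  moreover have "0 \<le> spectral_radius ?Q"
    using spectral_radius_mem_max(1)[OF Q n] by auto
  \<comment> \<open>Dividing \<open>P\<close> by this \<open>s\<close> pushes the radius below 1 and
    leaves the growth rate \<open>t / s\<close> above 1.\<close>
  ultimately obtain s where s: "spectral_radius ?Q < s" "s < t" "0 < s"
    using dense[of "spectral_radius ?Q" t] by force
  define P' where "P' = (1 / s) \<cdot>\<^sub>m P"
  have P': "P' \<in> carrier_mat n n" using P by (simp add: P'_def)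
  have nn': "0 \<le> P' $$ (i, j)" if "i < n" "j < n" for i j
    using that nn P s by (simp add: P'_def)
  have "map_mat complex_of_real P' = complex_of_real (1 / s) \<cdot>\<^sub>m ?Q"
    by (rule eq_matI) (auto simp: P'_def)
  then have "spectral_radius (map_mat complex_of_real P') \<le> (1 / s) * spectral_radius ?Q"
    using spectral_radius_smult_le[OF Q n, of "1 / s"] s by simp
  also have "\<dots> < 1" using s by simp
  finally obtain c where c: "\<And>k. norm_bound (map_mat complex_of_real P' ^\<^sub>m k) c"
    using spectral_radius_jnf_norm_bound_less_1_upper_triangular[of "map_mat complex_of_real P'" n] P'
    by auto
  have bd: "(P' ^\<^sub>m k) $$ (i, j) \<le> c" if "i < n" "j < n" for i j k
  proof -
    have "norm (complex_of_real ((P' ^\<^sub>m k) $$ (i, j))) \<le> c"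
      using c[of k] that P' unfolding map_mat_of_real_pow[OF P'] norm_bound_def by simp
    then show ?thesis by simp
  qed
  have "(t / s) * w $ i \<le> (P' *\<^sub>v w) $ i" if "i < n" for i
  proof -
    have "(P' *\<^sub>v w) $ i = (1 / s) * (P *\<^sub>v w) $ i"
      unfolding mult_mat_vec_index[OF P' w that] mult_mat_vec_index[OF P w that]
      using that P by (simp add: P'_def sum_divide_distrib)
    then show ?thesis using ge[OF that] s by (simp add: field_simps)
  qed
  then have grow: "(t / s) ^ k * w $ 0 \<le> (P' ^\<^sub>m k *\<^sub>v w) $ 0" for k
    using pow_mat_mult_vec_ge[OF P' nn' w, of "t / s"] s n by simp
  have up: "(P' ^\<^sub>m k *\<^sub>v w) $ 0 \<le> (\<Sum>j<n. c * w $ j)" for k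
    unfolding mult_mat_vec_index[OF pow_carrier_mat[OF P'] w n]
    using bd n wpos by (intro sum_mono mult_right_mono) (auto intro: less_imp_le)
  obtain k where "(\<Sum>j<n. c * w $ j) / w $ 0 < (t / s) ^ k"
    using real_arch_pow[of "t / s"] s by auto
  then have "(\<Sum>j<n. c * w $ j) < (t / s) ^ k * w $ 0"
    using wpos[OF n] by (simp add: field_simps)
  with grow[of k] up[of k] show False by linarith
qed

text \<open>Wielandt's argument: the moduli \<open>y\<close> of an eigenvector for an eigenvalue of
  maximal modulus \<open>r\<close> satisfy \<open>r y \<le> P y\<close>. A strict entry would become
  strict everywhere after one more application of \<open>P\<close>, so \<open>w = P y\<close> would
  be subinvariant with a factor above \<open>r\<close>.\<close>

lemma positive_mat_positive_eigenvector:
  fixes P :: "real mat"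
  assumes P: "P \<in> carrier_mat n n" and n: "0 < n"
    and pos: "\<And>i j. i < n \<Longrightarrow> j < n \<Longrightarrow> 0 < P $$ (i, j)"
  obtains v r where "v \<in> carrier_vec n" "\<And>i. i < n \<Longrightarrow> 0 < v $ i" "P *\<^sub>v v = r \<cdot>\<^sub>v v"
proof -
  let ?Q = "map_mat complex_of_real P"
  define r where "r = spectral_radius ?Q"
  have Q: "?Q \<in> carrier_mat n n" using P by simp
  obtain e x where e: "r = norm e" and x: "eigenvector ?Q x e"
    using spectral_radius_mem_max(1)[OF Q n]
    by (auto simp: r_def spectrum_def eigenvalue_def)
  have r0: "0 \<le> r" using e by simp
  have xc: "x \<in> carrier_vec n" and x0: "x \<noteq> 0\<^sub>v n" and Qx: "?Q *\<^sub>v x = e \<cdot>\<^sub>v x"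
    using x P by (auto simp: eigenvector_def)
  define y where "y = vec n (\<lambda>i. norm (x $ i))"
  have yc: "y \<in> carrier_vec n" and y0: "\<And>i. i < n \<Longrightarrow> 0 \<le> y $ i" by (auto simp: y_def)
  define w where "w = P *\<^sub>v y"
  have wc: "w \<in> carrier_vec n" using P yc by (simp add: w_def)
  have wi: "w $ i = (\<Sum>j<n. P $$ (i, j) * y $ j)" if "i < n" for i
    unfolding w_def by (rule mult_mat_vec_index[OF P yc that])
  have ge: "r * y $ i \<le> w $ i" if i: "i < n" for i
  proof -
    have "r * y $ i = norm ((?Q *\<^sub>v x) $ i)" using i xc by (simp add: Qx e y_def norm_mult)
    also have "\<dots> \<le> (\<Sum>j<n. norm (?Q $$ (i, j) * x $ j))"
      unfolding mult_mat_vec_index[OF Q xc i] by (rule norm_sum)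
    also have "\<dots> = w $ i"
      using i P pos unfolding wi[OF i]
      by (intro sum.cong) (auto simp: norm_mult y_def less_imp_le)
    finally show ?thesis .
  qed
  obtain l where l: "l < n" "x $ l \<noteq> 0" using x0 xc by (metis eq_vecI carrier_vecD index_zero_vec)
  have strict: "0 < (P *\<^sub>v u) $ i" if u: "u \<in> carrier_vec n" "\<And>i. i < n \<Longrightarrow> 0 \<le> u $ i" "l < n" "0 < u $ l"
    and i: "i < n" for u l i
    unfolding mult_mat_vec_index[OF P u(1) i]
    using u pos i by (intro sum_pos2[of _ l]) (auto intro!: mult_nonneg_nonneg less_imp_le[OF pos])
  have wpos: "0 < w $ i" if "i < n" for i
    unfolding w_def using strict[OF yc y0 l(1) _ that] l by (simp add: y_def)
  have eq: "w $ i = r * y $ i" if i: "i < n" for i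
  proof (rule ccontr)
    assume ne: "w $ i \<noteq> r * y $ i"
    \<comment> \<open>The defect of \<open>r y \<le> w\<close>: nonnegative and nonzero at
      \<open>i\<close>, so \<open>P u = P w - r w\<close> is positive everywhere.\<close>
    define u where "u = vec n (\<lambda>i. w $ i - r * y $ i)"
    have uc: "u \<in> carrier_vec n" by (simp add: u_def)
    have Pu: "(P *\<^sub>v u) $ j = (P *\<^sub>v w) $ j - r * w $ j" if j: "j < n" for j
      unfolding mult_mat_vec_index[OF P uc j] mult_mat_vec_index[OF P wc j] wi[OF j]
      by (simp add: u_def algebra_simps sum_subtractf sum_distrib_left)
    have Pu0: "0 < (P *\<^sub>v u) $ j" if "j < n" for j
      using ge ne i by (intro strict[OF uc _ i _ that]) (auto simp: u_def less_le)
    \<comment> \<open>The largest \<open>d\<close> with \<open>d w \<le> P u\<close>; it is positive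
      as a minimum of finitely many positive ratios.\<close>
    define d where "d = Min ((\<lambda>j. (P *\<^sub>v u) $ j / w $ j) ` {..<n})"
    have d0: "0 < d" unfolding d_def using n Pu0 wpos by (subst Min_gr_iff) auto
    have dle: "d * w $ j \<le> (P *\<^sub>v u) $ j" if "j < n" for j
    proof -
      have "d \<le> (P *\<^sub>v u) $ j / w $ j" unfolding d_def using that by (intro Min_le) auto
      then show ?thesis using wpos[OF that] by (simp add: field_simps)
    qed
    have "(r + d) * w $ j \<le> (P *\<^sub>v w) $ j" if "j < n" for j
      using dle[OF that] Pu[OF that] by (simp add: algebra_simps)
    from subinvariance_le_spectral_radius[OF P n less_imp_le[OF pos] wc wpos this]
    show False using d0 by (simp add: r_def)
  qed
  have ypos: "0 < y $ i" if "i < n" for i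
    using wpos[OF that] eq[OF that] r0 y0[OF that] by (auto simp: zero_less_mult_iff)
  have "P *\<^sub>v y = r \<cdot>\<^sub>v y"
    using eq yc wc unfolding w_def[symmetric] by (intro eq_vecI) auto
  then show ?thesis using that yc ypos by blast
qed

section \<open>Cospectral nonnegative matrices with constant row sums\<close>

lemma tendsto_det:
  fixes M :: "nat \<Rightarrow> 'a :: {real_normed_field} mat"
  assumes M: "\<And>k. M k \<in> carrier_mat n n" and L: "L \<in> carrier_mat n n"
    and lim: "\<And>i j. i < n \<Longrightarrow> j < n \<Longrightarrow> (\<lambda>k. M k $$ (i, j)) \<longlonglongrightarrow> L $$ (i, j)"
  shows "(\<lambda>k. det (M k)) \<longlonglongrightarrow> det L"
  unfolding det_def'[OF M] det_def'[OF L]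
proof (intro tendsto_intros lim)
  fix p i assume "p \<in> {p. p permutes {0..<n}}" "i \<in> {0..<n}"
  then show "i < n" "p i < n" by (auto simp: permutes_in_image)
qed

lemma tendsto_poly_char_poly:
  fixes M :: "nat \<Rightarrow> real mat"
  assumes M: "\<And>k. M k \<in> carrier_mat n n" and L: "L \<in> carrier_mat n n"
    and lim: "\<And>i j. i < n \<Longrightarrow> j < n \<Longrightarrow> (\<lambda>k. M k $$ (i, j)) \<longlonglongrightarrow> L $$ (i, j)"
  shows "(\<lambda>k. poly (char_poly (M k)) x) \<longlonglongrightarrow> poly (char_poly L) x"
  unfolding char_poly_matrix[OF M] char_poly_matrix[OF L]
proof (rule tendsto_det[of _ n])
  fix i j assume ij: "i < n" "j < n"
  have eq: "(- char_matrix A x) $$ (i, j) = - (A $$ (i, j) + - x * (if i = j then 1 else 0))"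
    if "A \<in> carrier_mat n n" for A
    using that ij by (simp add: char_matrix_def)
  show "(\<lambda>k. (- char_matrix (M k) x) $$ (i, j)) \<longlonglongrightarrow> (- char_matrix L x) $$ (i, j)"
    unfolding eq[OF M] eq[OF L] by (intro tendsto_intros lim ij)
qed (use M L in auto)

text \<open>Bolzano-Weierstrass one coordinate at a time: a monotone subsequence settles the new
  coordinate, and the earlier limits survive the refinement.\<close>

lemma finite_family_convergent_subseq:
  fixes f :: "nat \<Rightarrow> 'a \<Rightarrow> real"
  assumes "finite S" and "\<And>x. x \<in> S \<Longrightarrow> Bseq (\<lambda>k. f k x)"
  shows "\<exists>s l. strict_mono s \<and> (\<forall>x\<in>S. (\<lambda>k. f (s k) x) \<longlonglongrightarrow> l x)"
  using assms
proof (induction S rule: finite_induct)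
  case empty
  show ?case using strict_mono_id by blast
next
  case (insert a S)
  then obtain s l where s: "strict_mono s" and l: "\<forall>x\<in>S. (\<lambda>k. f (s k) x) \<longlonglongrightarrow> l x" by auto
  obtain t where t: "strict_mono t" and "monoseq (\<lambda>k. f (s (t k)) a)"
    using seq_monosub[of "\<lambda>k. f (s k) a"] by auto
  moreover have "Bseq (\<lambda>k. f (s (t k)) a)"
    using Bseq_subseq[of "\<lambda>k. f k a" "\<lambda>k. s (t k)"] insert.prems by simp
  ultimately obtain b where b: "(\<lambda>k. f (s (t k)) a) \<longlonglongrightarrow> b"
    using Bseq_monoseq_convergent by (auto simp: convergent_def)
  have "(\<lambda>k. f (s (t k)) x) \<longlonglongrightarrow> (l(a := b)) x" if "x \<in> insert a S" for x
    using that b l LIMSEQ_subseq_LIMSEQ[of "\<lambda>k. f (s k) x" "l x" t] t insert.hyps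
    by (auto simp: o_def)
  moreover have "strict_mono (\<lambda>k. s (t k))"
    using strict_mono_compose s t by (auto simp: strict_mono_def)
  ultimately show ?case by blast
qed

text \<open>Conjugation by the diagonal matrix of the Perron vector turns that vector into the
  all-ones vector. The bound on \<open>r\<close> supplies the compactness for the later passage to
  the limit.\<close>

lemma positive_mat_constant_row_sums:
  fixes P :: "real mat"
  assumes P: "P \<in> carrier_mat n n" and n: "0 < n"
    and pos: "\<And>i j. i < n \<Longrightarrow> j < n \<Longrightarrow> 0 < P $$ (i, j)"
  obtains B r where "B \<in> carrier_mat n n" "\<And>i j. i < n \<Longrightarrow> j < n \<Longrightarrow> 0 \<le> B $$ (i, j)"
    "\<And>i. i < n \<Longrightarrow> (\<Sum>j<n. B $$ (i, j)) = r" "char_poly B = char_poly P"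
    "r \<le> (\<Sum>i<n. \<Sum>j<n. P $$ (i, j))"
proof -
  obtain v r where v: "v \<in> carrier_vec n" and vpos: "\<And>i. i < n \<Longrightarrow> 0 < v $ i"
    and Pv: "P *\<^sub>v v = r \<cdot>\<^sub>v v"
    using positive_mat_positive_eigenvector[OF P n pos] by blast
  have Pvi: "(\<Sum>j<n. P $$ (i, j) * v $ j) = r * v $ i" if "i < n" for i
    using mult_mat_vec_index[OF P v that] Pv that v by simp
  define D where "D = mat n n (\<lambda>(i, j). if i = j then v $ i else 0)"
  define E where "E = mat n n (\<lambda>(i, j). if i = j then 1 / v $ i else 0)"
  define B where "B = mat n n (\<lambda>(i, j). P $$ (i, j) * v $ j / v $ i)"
  have v0: "v $ i \<noteq> 0" if "i < n" for i using vpos[OF that] by simp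
  have c: "D \<in> carrier_mat n n" "E \<in> carrier_mat n n" "B \<in> carrier_mat n n"
    by (auto simp: D_def E_def B_def)
  have ED: "E * D = 1\<^sub>m n" "D * E = 1\<^sub>m n"
    by (rule eq_matI;
        auto simp: D_def E_def scalar_prod_def v0 if_distrib[of "\<lambda>x. x * _"] cong: if_cong)+
  have EP: "E * P = mat n n (\<lambda>(i, j). P $$ (i, j) / v $ i)"
    using P by (intro eq_matI)
      (auto simp: E_def scalar_prod_def if_distrib[of "\<lambda>x. x * _"] cong: if_cong)
  have "B = E * P * D" unfolding EP
    by (rule eq_matI)
      (auto simp: B_def D_def scalar_prod_def if_distrib[of "\<lambda>x. _ * x"] cong: if_cong)
  then have sim: "char_poly B = char_poly P"
    using similar_matI[of B P E D n] c P ED by (intro char_poly_similar) auto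
  have rows: "(\<Sum>j<n. B $$ (i, j)) = r" if "i < n" for i
    using Pvi[OF that] v0[OF that] that by (simp add: B_def sum_divide_distrib[symmetric])
  \<comment> \<open>In a row \<open>i\<close> where \<open>v\<close> is largest, the eigenvalue
    equation bounds \<open>r\<close> by the row sum of \<open>P\<close>.\<close>
  have "Max ((\<lambda>i. v $ i) ` {..<n}) \<in> (\<lambda>i. v $ i) ` {..<n}"
    using n by (intro Max_in) auto
  then obtain i where i: "i < n" "v $ i = Max ((\<lambda>i. v $ i) ` {..<n})" by auto
  have vmax: "v $ j \<le> v $ i" if "j < n" for j
    unfolding i(2) using that by (intro Max_ge) auto
  have "r * v $ i = (\<Sum>j<n. P $$ (i, j) * v $ j)" using Pvi[OF i(1)] by simp
  also have "\<dots> \<le> (\<Sum>j<n. P $$ (i, j) * v $ i)"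
    using vmax pos[OF i(1)] by (intro sum_mono mult_left_mono) (auto intro: less_imp_le)
  also have "\<dots> = (\<Sum>j<n. P $$ (i, j)) * v $ i" by (simp add: sum_distrib_right)
  finally have "r \<le> (\<Sum>j<n. P $$ (i, j))" using vpos[OF i(1)] by simp
  also have "\<dots> \<le> (\<Sum>i<n. \<Sum>j<n. P $$ (i, j))"
    using i(1) pos by (intro member_le_sum) (auto intro!: sum_nonneg less_imp_le[OF pos])
  finally have "r \<le> (\<Sum>i<n. \<Sum>j<n. P $$ (i, j))" .
  moreover have "0 \<le> B $$ (i, j)" if "i < n" "j < n" for i j
    using pos[OF that] vpos[OF that(1)] vpos[OF that(2)] that by (simp add: B_def)
  ultimately show ?thesis using that c(3) rows sim by blast
qed

text \<open>A Perron vector of \<open>A\<close> itself may have zeros, so scaling by it can fail.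
  The scaled perturbations, however, have entries between 0 and their common row sum, which is
  bounded in \<open>k\<close>; a limit point of them inherits the row sums and the characteristic
  polynomial.\<close>

lemma nonneg_mat_constant_row_sums:
  fixes A :: "real mat"
  assumes A: "A \<in> carrier_mat n n" and n: "0 < n"
    and nn: "\<And>i j. i < n \<Longrightarrow> j < n \<Longrightarrow> 0 \<le> A $$ (i, j)"
  obtains B r where "B \<in> carrier_mat n n" "\<And>i j. i < n \<Longrightarrow> j < n \<Longrightarrow> 0 \<le> B $$ (i, j)"
    "\<And>i. i < n \<Longrightarrow> (\<Sum>j<n. B $$ (i, j)) = r" "char_poly B = char_poly A"
proof -
  define P where "P k = mat n n (\<lambda>(i, j). A $$ (i, j) + 1 / real (Suc k))" for k
  have P: "P k \<in> carrier_mat n n" for k by (simp add: P_def)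
  have Ppos: "0 < P k $$ (i, j)" if "i < n" "j < n" for k i j
    using nn[OF that] that by (simp add: P_def add_nonneg_pos)
  have "\<exists>B r. B \<in> carrier_mat n n \<and> (\<forall>i<n. \<forall>j<n. 0 \<le> B $$ (i, j)) \<and>
      (\<forall>i<n. (\<Sum>j<n. B $$ (i, j)) = r) \<and> char_poly B = char_poly (P k) \<and>
      r \<le> (\<Sum>i<n. \<Sum>j<n. P k $$ (i, j))" for k
    using positive_mat_constant_row_sums[OF P n Ppos, of k] by metis
  then obtain B r where B: "\<And>k. B k \<in> carrier_mat n n"
    and Bnn: "\<And>k i j. i < n \<Longrightarrow> j < n \<Longrightarrow> 0 \<le> B k $$ (i, j)"
    and rows: "\<And>k i. i < n \<Longrightarrow> (\<Sum>j<n. B k $$ (i, j)) = r k"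
    and cp: "\<And>k. char_poly (B k) = char_poly (P k)"
    and r: "\<And>k. r k \<le> (\<Sum>i<n. \<Sum>j<n. P k $$ (i, j))"
    by metis
  \<comment> \<open>Bounds the total of every \<open>P k\<close>, because
    \<open>1 / (k + 1) \<le> 1\<close>.\<close>
  define C where "C = (\<Sum>i<n. \<Sum>j<n. A $$ (i, j) + 1)"
  have rC: "r k \<le> C" for k
  proof -
    have "(\<Sum>i<n. \<Sum>j<n. P k $$ (i, j)) \<le> C"
      unfolding C_def by (intro sum_mono) (auto simp: P_def)
    with r[of k] show ?thesis by linarith
  qed
  have bd: "B k $$ (i, j) \<le> C" if "i < n" "j < n" for k i j
  proof -
    have "B k $$ (i, j) \<le> (\<Sum>j<n. B k $$ (i, j))"
      using that Bnn by (intro member_le_sum) auto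
    then show ?thesis using rows[OF that(1), of k] rC[of k] by linarith
  qed
  have "Bseq (\<lambda>k. B k $$ ij)" if "ij \<in> {..<n} \<times> {..<n}" for ij
    using that bd Bnn by (intro BseqI'[of _ C]) auto
  then obtain s l where s: "strict_mono s"
    and l: "\<And>i j. i < n \<Longrightarrow> j < n \<Longrightarrow> (\<lambda>k. B (s k) $$ (i, j)) \<longlonglongrightarrow> l (i, j)"
    using finite_family_convergent_subseq[of "{..<n} \<times> {..<n}" "\<lambda>k ij. B k $$ ij"] by fastforce
  define L where "L = mat n n l"
  have L: "L \<in> carrier_mat n n" by (simp add: L_def)
  have lim: "(\<lambda>k. B (s k) $$ (i, j)) \<longlonglongrightarrow> L $$ (i, j)" if "i < n" "j < n" for i j
    using l[OF that] that by (simp add: L_def)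
  have "0 \<le> L $$ (i, j)" if "i < n" "j < n" for i j
    using lim[OF that] Bnn[OF that] by (intro LIMSEQ_le_const) auto
  \<comment> \<open>Row 0 serves as reference: every row sum of \<open>L\<close> is the limit of the
    same sequence \<open>r (s k)\<close>.\<close>
  moreover have "(\<Sum>j<n. L $$ (i, j)) = (\<Sum>j<n. L $$ (0, j))" if "i < n" for i
  proof (rule LIMSEQ_unique)
    show "(\<lambda>k. r (s k)) \<longlonglongrightarrow> (\<Sum>j<n. L $$ (i, j))"
      unfolding rows[OF that, symmetric] using that by (intro tendsto_sum lim) auto
    show "(\<lambda>k. r (s k)) \<longlonglongrightarrow> (\<Sum>j<n. L $$ (0, j))"
      unfolding rows[OF n, symmetric] using n by (intro tendsto_sum lim) auto
  qed
  moreover have "char_poly L = char_poly A"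
  proof (rule poly_eq_poly_eq_iff[THEN iffD1], rule ext)
    fix x
    have "(\<lambda>k. poly (char_poly (B (s k))) x) \<longlonglongrightarrow> poly (char_poly L) x"
      by (rule tendsto_poly_char_poly[OF B L lim])
    moreover have "(\<lambda>k. poly (char_poly (P k)) x) \<longlonglongrightarrow> poly (char_poly A) x"
    proof (rule tendsto_poly_char_poly[OF P A])
      fix i j assume "i < n" "j < n"
      then show "(\<lambda>k. P k $$ (i, j)) \<longlonglongrightarrow> A $$ (i, j)"
        using tendsto_add[OF tendsto_const[of "A $$ (i, j)"] LIMSEQ_Suc[OF lim_1_over_n[where 'a=real]]]
        by (simp add: P_def)
    qed
    then have "(\<lambda>k. poly (char_poly (B (s k))) x) \<longlonglongrightarrow> poly (char_poly A) x"
      unfolding cp using LIMSEQ_subseq_LIMSEQ[OF _ s] by (fastforce simp: o_def)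
    ultimately show "poly (char_poly L) x = poly (char_poly A) x" by (rule LIMSEQ_unique)
  qed
  ultimately show ?thesis using that L by blast
qed

section \<open>Characteristic polynomial of the bordered matrix\<close>

lemma det_one_minus_column:
  fixes g :: "nat \<Rightarrow> 'a :: comm_ring_1"
  assumes p: "p < n"
  shows "det (mat n n (\<lambda>(i, j). (if i = j then 1 else 0) - (if j = p then g i else 0))) = 1 - g p"
    (is "det ?T = _")
proof -
  have T: "?T \<in> carrier_mat n n" by simp
  have "mat_delete ?T p p = 1\<^sub>m (n - 1)"
    using p by (intro eq_matI) (auto simp: mat_delete_def)
  then have cof: "cofactor ?T p p = 1" by (simp add: cofactor_def)
  \<comment> \<open>Row \<open>p\<close> has its only possibly nonzero entry on the
    diagonal.\<close>
  have "det ?T = (\<Sum>j<n. ?T $$ (p, j) * cofactor ?T p j)"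
    by (rule laplace_expansion_row[OF T p])
  also have "\<dots> = (\<Sum>j\<in>{p}. ?T $$ (p, j) * cofactor ?T p j)"
    using p by (intro sum.mono_neutral_right) auto
  also have "\<dots> = 1 - g p" using p cof by simp
  finally show ?thesis .
qed

text \<open>As a weighted digraph: vertex \<open>i\<close> of \<open>B\<close> enters a path at its
  vertex 0 with weight \<open>z $ i\<close>, and path vertex \<open>i\<close> returns to vertex
  \<open>p\<close> of \<open>B\<close> with weight \<open>c i\<close>. A return from there has
  passed \<open>i + 1\<close> path vertices, hence the terms \<open>c i / y ^ Suc i\<close> in the
  Schur complement.\<close>

definition bordered_mat ::
    "nat \<Rightarrow> real \<Rightarrow> (nat \<Rightarrow> real) \<Rightarrow> nat \<Rightarrow> real vec \<Rightarrow> nat \<Rightarrow> real mat \<Rightarrow> real mat" where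
  "bordered_mat d \<gamma> c m z p B = four_block_mat
     (mat d d (\<lambda>(i, j). if i = j then \<gamma> else if j = Suc i then 1 else 0))
     (mat d m (\<lambda>(i, j). if j = p then c i else 0))
     (mat m d (\<lambda>(i, j). if j = 0 then z $ i else 0))
     B"

lemma bordered_mat_carrier:
  "B \<in> carrier_mat m m \<Longrightarrow> bordered_mat d \<gamma> c m z p B \<in> carrier_mat (d + m) (d + m)"
  by (simp add: bordered_mat_def)

text \<open>The elimination divides by powers of \<open>y\<close> and by \<open>q\<close>, so it is
  done at a single point \<open>x\<close> where both are nonzero.\<close>

lemma poly_char_poly_bordered_mat:
  assumes B: "B \<in> carrier_mat m m" and z: "z \<in> carrier_vec m" and p: "p < m"
    and quad: "B *\<^sub>v (B *\<^sub>v z) = (\<rho> + l) \<cdot>\<^sub>v (B *\<^sub>v z) - (\<rho> * l) \<cdot>\<^sub>v z"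
    and zp: "z $ p = 0" and y: "y = x - \<gamma>" "y \<noteq> 0"
    and q: "q = (x - \<rho>) * (x - l)" "q \<noteq> 0"
  shows "q * poly (char_poly (bordered_mat d \<gamma> c m z p B)) x =
    poly (char_poly B) x * (y ^ d * q - (\<Sum>j<d. (B *\<^sub>v z) $ p * c j * y ^ (d - 1 - j)))"
proof -
  define Bz where "Bz = B *\<^sub>v z"
  have Bz: "Bz \<in> carrier_vec m" using B z by (simp add: Bz_def)
  \<comment> \<open>Clearing \<open>G\<close> by rows leaves \<open>H\<close> minus \<open>\<sigma>\<close> times \<open>z\<close> in column \<open>p\<close>; since \<open>H g = q z\<close>, this is \<open>H T\<close>.\<close>
  define \<sigma> where "\<sigma> = (\<Sum>j<d. c j / y ^ Suc j)"
  define g where "g = vec m (\<lambda>i. Bz $ i + (x - \<rho> - l) * z $ i)"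
  define H where "H = - char_matrix B x"
  define E where "E = mat d d (\<lambda>(i, j). if i = j then y else if j = Suc i then - 1 else 0)"
  define F where "F = mat d m (\<lambda>(i, j). if j = p then - c i else 0)"
  define G where "G = mat m d (\<lambda>(i, j). if j = 0 then - z $ i else 0)"
  define S where "S = mat m d (\<lambda>(i, j). z $ i / y ^ Suc j)"
  define T where "T = mat m m (\<lambda>(i, j). (if i = j then 1 else 0) - (if j = p then \<sigma> / q * g $ i else 0))"
  have carr: "E \<in> carrier_mat d d" "F \<in> carrier_mat d m" "G \<in> carrier_mat m d"
    "S \<in> carrier_mat m d" "T \<in> carrier_mat m m" "H \<in> carrier_mat m m"
    using B by (auto simp: E_def F_def G_def S_def T_def H_def)
  have Hij: "H $$ (i, j) = (if i = j then x else 0) - B $$ (i, j)" if "i < m" "j < m" for i j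
    using that B by (auto simp: H_def char_matrix_def)
  let ?M = "bordered_mat d \<gamma> c m z p B"
  have X: "- char_matrix ?M x = four_block_mat E F G H"
    using B by (intro eq_matI)
      (auto simp: char_matrix_def bordered_mat_def E_def F_def G_def H_def y)
  \<comment> \<open>Row \<open>i\<close> of \<open>S\<close> is geometric with ratio
    \<open>1 / y\<close>, so the two contributions to a column of \<open>S E\<close> cancel except
    in column 0, where \<open>z $ i\<close> remains.\<close>
  have SE: "S * E + G = 0\<^sub>m m d"
  proof (rule eq_matI)
    fix i j assume "i < dim_row (0\<^sub>m m d)" "j < dim_col (0\<^sub>m m d :: real mat)"
    then have ij: "i < m" "j < d" by auto
    have "(S * E) $$ (i, j) = (\<Sum>k<d. z $ i / y ^ Suc k * (if k = j then y else if j = Suc k then - 1 else 0))"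
      using ij by (simp add: S_def E_def scalar_prod_def lessThan_atLeast0)
    also have "\<dots> = (\<Sum>k<d. if k = j then z $ i / y ^ j else 0)
                   - (\<Sum>k<d. if j = Suc k then z $ i / y ^ Suc k else 0)"
      unfolding sum_subtractf[symmetric] using y(2) by (intro sum.cong) auto
    also have "(\<Sum>k<d. if j = Suc k then z $ i / y ^ Suc k else 0) = (if j = 0 then 0 else z $ i / y ^ j)"
      using ij by (cases j) auto
    also have "(\<Sum>k<d. if k = j then z $ i / y ^ j else 0) = z $ i / y ^ j" using ij by simp
    finally show "(S * E + G) $$ (i, j) = 0\<^sub>m m d $$ (i, j)"
      using ij carr by (simp add: G_def)
  qed (use carr in auto)
  \<comment> \<open>By \<open>quad\<close>, the product \<open>(x - B) (B + x - \<rho> - l)\<close>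
    acts on \<open>z\<close> as the scalar \<open>q\<close>.\<close>
  have Hg: "(\<Sum>k<m. H $$ (i, k) * g $ k) = q * z $ i" if i: "i < m" for i
  proof -
    have BBz: "(\<Sum>k<m. B $$ (i, k) * Bz $ k) = (\<rho> + l) * Bz $ i - \<rho> * l * z $ i"
      unfolding mult_mat_vec_index[OF B Bz i, symmetric] using i z B by (simp add: quad Bz_def)
    have Bzi: "(\<Sum>k<m. B $$ (i, k) * z $ k) = Bz $ i"
      using mult_mat_vec_index[OF B z i] by (simp add: Bz_def)
    have "(\<Sum>k<m. H $$ (i, k) * g $ k)
        = (\<Sum>k<m. (if k = i then x * g $ i else 0) - (B $$ (i, k) * Bz $ k + (x - \<rho> - l) * (B $$ (i, k) * z $ k)))"
      using i by (intro sum.cong) (auto simp: Hij g_def algebra_simps)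
    also have "\<dots> = x * g $ i - ((\<rho> + l) * Bz $ i - \<rho> * l * z $ i + (x - \<rho> - l) * Bz $ i)"
      unfolding sum_subtractf sum.distrib sum_distrib_left[symmetric] BBz Bzi using i by simp
    also have "\<dots> = q * z $ i" using i by (simp add: g_def q(1) algebra_simps)
    finally show ?thesis .
  qed
  have SF: "S * F + H = H * T"
  proof (rule eq_matI)
    fix i j assume "i < dim_row (H * T)" "j < dim_col (H * T)"
    then have ij: "i < m" "j < m" using carr by auto
    have "(H * T) $$ (i, j) = (\<Sum>k<m. H $$ (i, k) * T $$ (k, j))"
      using ij carr by (simp add: scalar_prod_def lessThan_atLeast0)
    also have "\<dots> = (\<Sum>k<m. (if k = j then H $$ (i, j) else 0)
        - (if j = p then \<sigma> / q else 0) * (H $$ (i, k) * g $ k))"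
      using ij by (intro sum.cong) (auto simp: T_def algebra_simps)
    also have "\<dots> = H $$ (i, j) - (if j = p then \<sigma> * z $ i else 0)"
      unfolding sum_subtractf sum_distrib_left[symmetric] Hg[OF ij(1)] using ij q(2) by simp
    also have "\<dots> = (S * F + H) $$ (i, j)"
      using ij carr(6) by (auto simp: S_def F_def scalar_prod_def \<sigma>_def lessThan_atLeast0
          sum_distrib_left sum_negf mult.commute)
    finally show "(S * F + H) $$ (i, j) = (H * T) $$ (i, j)" by simp
  qed (use carr in auto)
  let ?L = "four_block_mat (1\<^sub>m d) (0\<^sub>m d m) S (1\<^sub>m m)"
  have "?L * four_block_mat E F G H = four_block_mat E F (0\<^sub>m m d) (H * T)"
    using carr SE SF by (subst mult_four_block_mat[of _ d d _ m _ m _ _ d _ m]) auto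
  moreover have "det (?L * four_block_mat E F G H) = det ?L * det (four_block_mat E F G H)"
    using carr by (intro det_mult[of _ "d + m"]) auto
  moreover have "det ?L = 1"
    using carr by (subst det_four_block_mat_upper_right_zero[of _ d _ m]) auto
  moreover have "det (four_block_mat E F (0\<^sub>m m d) (H * T)) = det E * det (H * T)"
    using carr by (intro det_four_block_mat_lower_left_zero) auto
  moreover have "det (H * T) = det H * det T"
    using carr by (intro det_mult) auto
  moreover have "det T = 1 - \<sigma> / q * g $ p"
    unfolding T_def by (rule det_one_minus_column[OF p])
  moreover have "det E = y ^ d"
  proof -
    have "det E = prod_list (diag_mat E)"
      by (rule det_upper_triangular[OF _ carr(1)]) (auto simp: E_def)
    also have "diag_mat E = map (\<lambda>_. y) [0..<d]" by (auto simp: diag_mat_def E_def)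
    finally show ?thesis by (simp add: map_replicate_const)
  qed
  ultimately have "det (four_block_mat E F G H) = y ^ d * (det H * (1 - \<sigma> / q * g $ p))"
    by simp
  \<comment> \<open>The zero of \<open>z\<close> at \<open>p\<close> removes the part of
    \<open>g $ p\<close> that is linear in \<open>x\<close>, so each \<open>c j\<close> meets a
    constant factor.\<close>
  moreover have "g $ p = Bz $ p" using p zp by (simp add: g_def)
  ultimately have "q * det (four_block_mat E F G H) = det H * (y ^ d * q - y ^ d * \<sigma> * Bz $ p)"
    using q(2) by (simp add: field_simps)
  moreover have "y ^ d * \<sigma> * Bz $ p = (\<Sum>j<d. Bz $ p * c j * y ^ (d - 1 - j))"
    unfolding \<sigma>_def sum_distrib_left sum_distrib_right
  proof (rule sum.cong)
    fix j assume "j \<in> {..<d}"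
    then have "y ^ d = y ^ (d - 1 - j) * y ^ Suc j"
      by (simp only: power_add[symmetric]) simp
    then show "y ^ d * (c j / y ^ Suc j) * Bz $ p = Bz $ p * c j * y ^ (d - 1 - j)"
      using y(2) by simp
  qed simp
  ultimately show ?thesis
    unfolding char_poly_matrix[OF bordered_mat_carrier[OF B]] char_poly_matrix[OF B] X
    by (simp add: H_def Bz_def)
qed

text \<open>The pointwise identity fails to apply at no more than three points, and a nonzero
  polynomial has finitely many roots.\<close>

lemma char_poly_bordered_mat:
  assumes B: "B \<in> carrier_mat m m" and z: "z \<in> carrier_vec m" and p: "p < m"
    and quad: "B *\<^sub>v (B *\<^sub>v z) = (\<rho> + l) \<cdot>\<^sub>v (B *\<^sub>v z) - (\<rho> * l) \<cdot>\<^sub>v z"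
    and zp: "z $ p = 0"
  shows "[:- \<rho>, 1:] * [:- l, 1:] * char_poly (bordered_mat d \<gamma> c m z p B) =
    char_poly B * ([:- \<gamma>, 1:] ^ d * ([:- \<rho>, 1:] * [:- l, 1:])
      - (\<Sum>j<d. Polynomial.smult ((B *\<^sub>v z) $ p * c j) ([:- \<gamma>, 1:] ^ (d - 1 - j))))"
    (is "?P = ?Q")
proof (rule ccontr)
  assume "?P \<noteq> ?Q"
  then have "finite {x. poly (?P - ?Q) x = 0}" by (intro poly_roots_finite) simp
  moreover have "UNIV - {\<gamma>, \<rho>, l} \<subseteq> {x. poly (?P - ?Q) x = 0}"
  proof
    fix x assume "x \<in> UNIV - {\<gamma>, \<rho>, l}"
    then have "x - \<gamma> \<noteq> 0" "(x - \<rho>) * (x - l) \<noteq> 0" by auto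
    from poly_char_poly_bordered_mat[OF B z p quad zp refl this(1) refl this(2), of d c]
    show "x \<in> {x. poly (?P - ?Q) x = 0}"
      by (simp add: poly_sum algebra_simps)
  qed
  ultimately have "finite (UNIV - {\<gamma>, \<rho>, l})" by (rule rev_finite_subset)
  then show False by (simp add: infinite_UNIV_char_0)
qed

section \<open>Eigenvalues and an invariant plane under constant row sums\<close>

lemma abs_root_char_poly_le_row_sum:
  fixes B :: "real mat"
  assumes B: "B \<in> carrier_mat n n" and nn: "\<And>i j. i < n \<Longrightarrow> j < n \<Longrightarrow> 0 \<le> B $$ (i, j)"
    and rows: "\<And>i. i < n \<Longrightarrow> (\<Sum>j<n. B $$ (i, j)) = r"
    and root: "poly (char_poly B) k = 0"
  shows "\<bar>k\<bar> \<le> r"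
proof -
  obtain v where v: "v \<in> carrier_vec n" "v \<noteq> 0\<^sub>v n" and Bv: "B *\<^sub>v v = k \<cdot>\<^sub>v v"
    using root B unfolding eigenvalue_root_char_poly[OF B, symmetric]
    by (auto simp: eigenvalue_def eigenvector_def)
  obtain l where l: "l < n" "v $ l \<noteq> 0" using v by (metis eq_vecI carrier_vecD index_zero_vec)
  \<comment> \<open>The eigenvalue equation is read in a row where the eigenvector has maximal
    modulus.\<close>
  have "Max ((\<lambda>i. \<bar>v $ i\<bar>) ` {..<n}) \<in> (\<lambda>i. \<bar>v $ i\<bar>) ` {..<n}"
    using l by (intro Max_in) auto
  then obtain i where i: "i < n" "\<bar>v $ i\<bar> = Max ((\<lambda>i. \<bar>v $ i\<bar>) ` {..<n})" by auto
  have vmax: "\<bar>v $ j\<bar> \<le> \<bar>v $ i\<bar>" if "j < n" for j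
    unfolding i(2) using that by (intro Max_ge) auto
  have "\<bar>k\<bar> * \<bar>v $ i\<bar> = \<bar>\<Sum>j<n. B $$ (i, j) * v $ j\<bar>"
    unfolding mult_mat_vec_index[OF B v(1) i(1), symmetric] Bv using v(1) i(1) by (simp add: abs_mult)
  also have "\<dots> \<le> (\<Sum>j<n. \<bar>B $$ (i, j) * v $ j\<bar>)" by (rule sum_abs)
  also have "\<dots> \<le> (\<Sum>j<n. B $$ (i, j) * \<bar>v $ i\<bar>)"
    using vmax nn[OF i(1)] by (intro sum_mono) (auto simp: abs_mult intro!: mult_left_mono)
  also have "\<dots> = r * \<bar>v $ i\<bar>" by (simp add: rows[OF i(1)] sum_distrib_right[symmetric])
  finally have "\<bar>k\<bar> * \<bar>v $ i\<bar> \<le> r * \<bar>v $ i\<bar>" .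
  moreover have "0 < \<bar>v $ i\<bar>" using vmax[OF l(1)] l(2) by linarith
  ultimately show ?thesis by simp
qed

lemma row_sum_root_char_poly:
  fixes B :: "real mat"
  assumes B: "B \<in> carrier_mat n n" and n: "0 < n"
    and rows: "\<And>i. i < n \<Longrightarrow> (\<Sum>j<n. B $$ (i, j)) = r"
  shows "poly (char_poly B) r = 0"
proof -
  define e :: "real vec" where "e = vec n (\<lambda>_. 1)"
  have e: "e \<in> carrier_vec n" by (simp add: e_def)
  have "B *\<^sub>v e = r \<cdot>\<^sub>v e"
  proof (rule eq_vecI)
    fix i assume "i < dim_vec (r \<cdot>\<^sub>v e)"
    then have "i < n" by (simp add: e_def)
    then show "(B *\<^sub>v e) $ i = (r \<cdot>\<^sub>v e) $ i"
      unfolding mult_mat_vec_index[OF B e \<open>i < n\<close>] by (simp add: e_def rows)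
  qed (use B e in auto)
  moreover have "e \<noteq> 0\<^sub>v n"
  proof
    assume "e = 0\<^sub>v n"
    then have "e $ 0 = 0\<^sub>v n $ 0" by simp
    then show False using n by (simp add: e_def)
  qed
  ultimately show ?thesis
    using e B unfolding eigenvalue_root_char_poly[OF B, symmetric]
    by (auto simp: eigenvalue_def eigenvector_def)
qed

text \<open>The plane is spanned by the all-ones vector and an eigenvector for \<open>l\<close>;
  both are annihilated by \<open>(B - \<rho>) (B - l)\<close>.\<close>

lemma nonneg_vec_in_invariant_plane:
  fixes B :: "real mat"
  assumes B: "B \<in> carrier_mat n n"
    and rows: "\<And>i. i < n \<Longrightarrow> (\<Sum>j<n. B $$ (i, j)) = \<rho>"
    and root: "poly (char_poly B) l = 0" and less: "l < \<rho>"
  obtains z p where "z \<in> carrier_vec n" "p < n" "\<And>i. i < n \<Longrightarrow> 0 \<le> z $ i" "z $ p = 0"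
    "0 < (B *\<^sub>v z) $ p"
    "B *\<^sub>v (B *\<^sub>v z) = (\<rho> + l) \<cdot>\<^sub>v (B *\<^sub>v z) - (\<rho> * l) \<cdot>\<^sub>v z"
proof -
  obtain v where v: "v \<in> carrier_vec n" "v \<noteq> 0\<^sub>v n" and Bv: "B *\<^sub>v v = l \<cdot>\<^sub>v v"
    using root B unfolding eigenvalue_root_char_poly[OF B, symmetric]
    by (auto simp: eigenvalue_def eigenvector_def)
  obtain k where k: "k < n" "v $ k \<noteq> 0" using v by (metis eq_vecI carrier_vecD index_zero_vec)
  \<comment> \<open>The sign makes entry \<open>k\<close> negative, hence the minimum
    \<open>u p\<close> too, and \<open>(B z) $ p = (\<rho> - l) (- u p)\<close> positive.\<close>
  define u where "u i = (if v $ k < 0 then v $ i else - v $ i)" for i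
  have uk: "u k < 0" using k by (simp add: u_def)
  have Bu: "(\<Sum>j<n. B $$ (i, j) * u j) = l * u i" if "i < n" for i
    using mult_mat_vec_index[OF B v(1) that] Bv v(1) that by (simp add: u_def sum_negf)
  have "Min (u ` {..<n}) \<in> u ` {..<n}" using k by (intro Min_in) auto
  then obtain p where p: "p < n" "u p = Min (u ` {..<n})" by auto
  have umin: "u p \<le> u i" if "i < n" for i
    unfolding p(2) using that by (intro Min_le) auto
  define z where "z = vec n (\<lambda>i. u i - u p)"
  have z: "z \<in> carrier_vec n" by (simp add: z_def)
  have Bz: "(B *\<^sub>v z) $ i = l * u i - \<rho> * u p" if "i < n" for i
    unfolding mult_mat_vec_index[OF B z that] using Bu[OF that] rows[OF that]
    by (simp add: z_def right_diff_distrib sum_subtractf sum_distrib_right[symmetric])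
  have Bzc: "B *\<^sub>v z \<in> carrier_vec n" using B z by simp
  have BBz: "(B *\<^sub>v (B *\<^sub>v z)) $ i = l * l * u i - \<rho> * \<rho> * u p" if "i < n" for i
  proof -
    have "(B *\<^sub>v (B *\<^sub>v z)) $ i = (\<Sum>j<n. l * (B $$ (i, j) * u j) - B $$ (i, j) * (\<rho> * u p))"
      unfolding mult_mat_vec_index[OF B Bzc that] 
      by (intro sum.cong) (simp_all add: Bz right_diff_distrib mult_ac del: index_mult_mat_vec)
    also have "\<dots> = l * l * u i - \<rho> * \<rho> * u p"
      unfolding sum_subtractf sum_distrib_left[symmetric] sum_distrib_right[symmetric]
        Bu[OF that] rows[OF that] by simp
    finally show ?thesis .
  qed
  have "B *\<^sub>v (B *\<^sub>v z) = (\<rho> + l) \<cdot>\<^sub>v (B *\<^sub>v z) - (\<rho> * l) \<cdot>\<^sub>v z"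
  proof (rule eq_vecI)
    fix i assume "i < dim_vec ((\<rho> + l) \<cdot>\<^sub>v (B *\<^sub>v z) - (\<rho> * l) \<cdot>\<^sub>v z)"
    then have i: "i < n" using z by simp
    then have "((\<rho> + l) \<cdot>\<^sub>v (B *\<^sub>v z) - (\<rho> * l) \<cdot>\<^sub>v z) $ i = (\<rho> + l) * (B *\<^sub>v z) $ i - \<rho> * l * z $ i"
      using z Bzc B by (simp del: index_mult_mat_vec)
    also have "\<dots> = (B *\<^sub>v (B *\<^sub>v z)) $ i"
      unfolding BBz[OF i] Bz[OF i] using i by (simp add: z_def algebra_simps)
    finally show "(B *\<^sub>v (B *\<^sub>v z)) $ i = ((\<rho> + l) \<cdot>\<^sub>v (B *\<^sub>v z) - (\<rho> * l) \<cdot>\<^sub>v z) $ i" ..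
  qed (use B z in auto)
  moreover have "0 < (B *\<^sub>v z) $ p"
  proof -
    have "(B *\<^sub>v z) $ p = (\<rho> - l) * - u p" using Bz[OF p(1)] by (simp add: algebra_simps)
    also have "0 < \<dots>" using less umin[OF k(1)] uk by (intro mult_pos_pos) auto
    finally show ?thesis .
  qed
  ultimately show ?thesis
    using that[OF z p(1)] umin p(1) by (simp add: z_def)
qed

section \<open>The polynomial \<open>w\<close> and the realising matrix\<close>

lemma w_poly_eq:
  assumes \<gamma>: "\<gamma> = (\<rho> + l - b 1) / 2" and b2: "b 2 = ((\<rho> - l)\<^sup>2 - (b 1)\<^sup>2) / 4"
  shows "w_poly (d + 2) \<gamma> b = [:- \<gamma>, 1:] ^ d * ([:- \<rho>, 1:] * [:- l, 1:])
    - (\<Sum>j<d. Polynomial.smult (b (j + 3)) ([:- \<gamma>, 1:] ^ (d - 1 - j)))"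
proof -
  define Y where "Y = [:- \<gamma>, 1:]"
  let ?f = "\<lambda>i. Polynomial.smult (b i) (Y ^ (d + 2 - i))"
  \<comment> \<open>The roots in \<open>Y\<close> are \<open>(b 1 + (\<rho> - l)) / 2\<close> and
    \<open>(b 1 - (\<rho> - l)) / 2\<close>; adding \<open>\<gamma>\<close> gives
    \<open>\<rho>\<close> and \<open>l\<close>.\<close>
  have quad: "Y ^ 2 - Polynomial.smult (b 1) Y - Polynomial.smult (b 2) 1 = [:- \<rho>, 1:] * [:- l, 1:]"
    by (simp add: Y_def power2_eq_square \<gamma> b2 field_simps)
  have "{1..d + 2} = {1, 2} \<union> {3..d + 2}" by auto
  then have "(\<Sum>i = 1..d + 2. ?f i) = (\<Sum>i\<in>{1, 2}. ?f i) + (\<Sum>i = 3..d + 2. ?f i)"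
    by (simp only:) (rule sum.union_disjoint; auto)
  also have "(\<Sum>i\<in>{1, 2}. ?f i) = Polynomial.smult (b 1) (Y ^ Suc d) + Polynomial.smult (b 2) (Y ^ d)"
    by simp
  also have "(\<Sum>i = 3..d + 2. ?f i) = (\<Sum>j<d. ?f (j + 3))"
    by (rule sum.reindex_bij_witness[of _ "\<lambda>j. j + 3" "\<lambda>i. i - 3"]) auto
  also have "\<dots> = (\<Sum>j<d. Polynomial.smult (b (j + 3)) (Y ^ (d - 1 - j)))"
    by (intro sum.cong) auto
  finally have "w_poly (d + 2) \<gamma> b =
      Y ^ d * (Y ^ 2 - Polynomial.smult (b 1) Y - Polynomial.smult (b 2) 1)
      - (\<Sum>j<d. Polynomial.smult (b (j + 3)) (Y ^ (d - 1 - j)))"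
    unfolding w_poly_def Y_def[symmetric]
    by (simp add: power_add algebra_simps power2_eq_square)
  then show ?thesis unfolding quad unfolding Y_def .
qed

theorem theorem2p6:
  fixes m n :: nat
    and \<rho> lam2 \<gamma> :: real
    and lam \<mu> :: "nat \<Rightarrow> complex"
    and b :: "nat \<Rightarrow> real"
  assumes "m \<ge> 2" and "n \<ge> 3"
    and "realisable (complex_of_real \<rho> # complex_of_real lam2 # map lam [3..<m+1])"
    and "perron_eigenvalue \<rho> (complex_of_real \<rho> # complex_of_real lam2 # map lam [3..<m+1])"
    and "\<rho> \<noteq> lam2"
    and "\<gamma> = (\<rho> + lam2 - b 1) / 2" and "\<gamma> \<ge> 0"
    and "b 2 = ((\<rho> - lam2)\<^sup>2 - (b 1)\<^sup>2) / 4"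
    and "\<And>i. 3 \<le> i \<Longrightarrow> i \<le> n \<Longrightarrow> b i \<ge> 0"
    and "mset (map \<mu> [1..<n+1]) = proots (map_poly complex_of_real (w_poly n \<gamma> b))"
  shows "realisable (map \<mu> [1..<n+1] @ map lam [3..<m+1])"
proof -
  let ?ls = "complex_of_real \<rho> # complex_of_real lam2 # map lam [3..<m+1]"
  let ?c = complex_of_real
  interpret hom: map_poly_comm_ring_hom complex_of_real ..
  have len: "length ?ls = m" using assms(1) by (simp only: list.size length_map length_upt)
  obtain A where A: "A \<in> carrier_mat m m" and Ann: "\<And>i j. i < m \<Longrightarrow> j < m \<Longrightarrow> 0 \<le> A $$ (i, j)"
    and Aroots: "proots (char_poly (map_mat ?c A)) = mset ?ls"
    and sr: "spectral_radius (map_mat ?c A) = \<rho>"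
    using assms(4) len unfolding perron_eigenvalue_def realises_def by metis
  have Ac: "map_mat ?c A \<in> carrier_mat m m" using A by simp
  have m: "0 < m" using assms(1) by simp
  have cpA: "char_poly (map_mat ?c A) = map_poly ?c (char_poly A)"
    by (rule of_real_hom.char_poly_hom[OF A])
  have monic: "char_poly M \<noteq> 0" if "M \<in> carrier_mat k k" for M :: "real mat" and k
    using degree_monic_char_poly[OF that] by auto
  have "set_mset (mset ?ls) = {x. poly (char_poly (map_mat ?c A)) x = 0}"
    unfolding Aroots[symmetric] using degree_monic_char_poly[OF Ac] by (intro set_count_proots) auto
  then have "poly (map_poly ?c (char_poly A)) x = 0" if "x \<in> set_mset (mset ?ls)" for x
    using that unfolding cpA by (metis mem_Collect_eq)
  from this[of "?c \<rho>"] this[of "?c lam2"]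
  have roots: "poly (char_poly A) \<rho> = 0" "poly (char_poly A) lam2 = 0" by simp_all
  have le: "\<bar>x\<bar> \<le> \<rho>" if "poly (char_poly A) x = 0" for x
  proof -
    have "?c x \<in> spectrum (map_mat ?c A)"
      using that unfolding spectrum_root_char_poly[OF Ac] cpA by simp
    then have "norm (?c x) \<le> spectral_radius (map_mat ?c A)"
      by (intro spectral_radius_mem_max(2)[OF Ac m] imageI)
    then show ?thesis by (simp add: sr)
  qed
  have less: "lam2 < \<rho>" using le[OF roots(2)] assms(5) by auto
  have lin: "proots ([:- x, 1:] * [:- y, 1:] * q) = {#x#} + {#y#} + proots q"
    if "q \<noteq> 0" for x y :: complex and q
  proof -
    have eq: "proots ([:- x, 1:] * [:- y, 1:]) = proots [:- x, 1:] + proots [:- y, 1:]"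
      by (rule proots_mult) simp_all
    have "[:- x, 1:] * [:- y, 1:] \<noteq> 0" by simp
    from proots_mult[OF this that] show ?thesis unfolding eq by simp
  qed
  obtain B r where B: "B \<in> carrier_mat m m" and Bnn: "\<And>i j. i < m \<Longrightarrow> j < m \<Longrightarrow> 0 \<le> B $$ (i, j)"
    and rows: "\<And>i. i < m \<Longrightarrow> (\<Sum>j<m. B $$ (i, j)) = r" and cpB: "char_poly B = char_poly A"
    using nonneg_mat_constant_row_sums[OF A m Ann] by blast
  \<comment> \<open>Here \<open>r\<close> is a root, so \<open>r \<le> \<rho>\<close> by the
    spectral radius; \<open>\<rho>\<close> is a root of \<open>char_poly B\<close>, so
    \<open>\<rho> \<le> r\<close> by the row sums.\<close>
  have "r = \<rho>"
    using le[of r] row_sum_root_char_poly[OF B m rows]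
      abs_root_char_poly_le_row_sum[OF B Bnn rows, of \<rho>] roots(1) cpB by auto
  with rows have rows: "\<And>i. i < m \<Longrightarrow> (\<Sum>j<m. B $$ (i, j)) = \<rho>" by simp
  obtain z p where z: "z \<in> carrier_vec m" and p: "p < m" and znn: "\<And>i. i < m \<Longrightarrow> 0 \<le> z $ i"
    and zp: "z $ p = 0" and \<kappa>: "0 < (B *\<^sub>v z) $ p"
    and quad: "B *\<^sub>v (B *\<^sub>v z) = (\<rho> + lam2) \<cdot>\<^sub>v (B *\<^sub>v z) - (\<rho> * lam2) \<cdot>\<^sub>v z"
    using nonneg_vec_in_invariant_plane[OF B rows _ less] roots(2) cpB by metis
  define d where "d = n - 2"
  have n: "n = d + 2" using assms(2) by (simp add: d_def)
  \<comment> \<open>Division by \<open>\<kappa> = (B z) $ p\<close> cancels the factor with which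
    \<open>c j\<close> enters the characteristic polynomial, leaving
    \<open>b (j + 3)\<close>.\<close>
  define c where "c j = b (j + 3) / (B *\<^sub>v z) $ p" for j
  define M where "M = bordered_mat d \<gamma> c m z p B"
  have M: "M \<in> carrier_mat (d + m) (d + m)" unfolding M_def by (rule bordered_mat_carrier[OF B])
  have "0 \<le> c j" if "j < d" for j
    unfolding c_def using assms(9) \<kappa> n that by (intro divide_nonneg_pos) auto
  then have Mnn: "0 \<le> M $$ (i, j)" if "i < d + m" "j < d + m" for i j
    using that B Bnn znn assms(7) by (auto simp: M_def bordered_mat_def)
  have id: "[:- \<rho>, 1:] * [:- lam2, 1:] * char_poly M = char_poly A * w_poly n \<gamma> b"
    unfolding M_def char_poly_bordered_mat[OF B z p quad zp] n w_poly_eq[OF assms(6,8)] cpB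
    using \<kappa> by (simp add: c_def)
  have "[:- \<rho>, 1:] * [:- lam2, 1:] * char_poly M \<noteq> 0"
    using monic[OF M] by (simp only: mult_eq_0_iff) simp
  then have w0: "w_poly n \<gamma> b \<noteq> 0" unfolding id by auto
  have lin_hom: "map_poly ?c [:- x, 1:] = [:- ?c x, 1:]" for x by simp
  have "[:- ?c \<rho>, 1:] * [:- ?c lam2, 1:] * map_poly ?c (char_poly M)
      = map_poly ?c (char_poly A) * map_poly ?c (w_poly n \<gamma> b)"
    using arg_cong[OF id, of "map_poly ?c"] by (simp only: hom.hom_mult lin_hom)
  moreover have "map_poly ?c (char_poly M) \<noteq> 0" "map_poly ?c (char_poly A) \<noteq> 0"
    "map_poly ?c (w_poly n \<gamma> b) \<noteq> 0"
    using monic[OF M] monic[OF A] w0 by auto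
  \<comment> \<open>Instead of dividing by the two linear factors, their roots are cancelled as
    multiset elements; the polynomials must be nonzero for \<open>proots\<close> to be
    additive.\<close>
  ultimately have "{#?c \<rho>#} + {#?c lam2#} + proots (map_poly ?c (char_poly M))
      = mset ?ls + mset (map \<mu> [1..<n+1])"
    using Aroots assms(10) lin[of "map_poly ?c (char_poly M)" "?c \<rho>" "?c lam2"]
    unfolding cpA by (metis proots_mult)
  then have "proots (char_poly (map_mat ?c M)) = mset (map \<mu> [1..<n+1] @ map lam [3..<m+1])"
    unfolding of_real_hom.char_poly_hom[OF M] by simp
  moreover have "length (map \<mu> [1..<n+1] @ map lam [3..<m+1]) = d + m"
    using assms(1) n by (simp only: length_append length_map length_upt)
  ultimately have "realises M (map \<mu> [1..<n+1] @ map lam [3..<m+1])"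
    using M Mnn by (simp only: realises_def) simp
  then show ?thesis unfolding realisable_def ..
qed

end
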